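(* Let $F_2$ and $F_3$ be non-empty finite subsets of $\mathbb{Z}^2$ with the same line sums (the same row sum in every row and the same column sum in every column). Let $F_1$ be a uniquely determined neighbour of $F_2$ and $F_3$. Put $\alpha = \alpha(F_2, F_1)$. Then $$\frac{|F_2 \cap F_3|}{|F_2|} \geq 1 - \frac{2 \sqrt{2}\, \alpha}{\sqrt{|F_2|}}.$$
   Context: For $F$ a finite subset of $\mathbb{Z}^2$, the row sum of row $i\in\mathbb{Z}$ is the number of $j \in \mathbb{Z}$ with $(i,j)\in F$, and the column sum of column $j\in\mathbb{Z}$ is the number of $i \in \mathbb{Z}$ with $(i,j)\in F$. The row and column sums together are called the line sums of $F$. A finite set $F\subset\mathbb{Z}^2$ is called uniquely determined (by its line sums) if every subset $F'$ of $\mathbb{Z}^2$ with exactly the same row and column sums as $F$ equals $F$. For finite $F, G\subset \mathbb{Z}^2$ with row sums $r_i^{F}, r_i^{G}$ ($i\in\mathbb{Z}$) and column sums $c_j^{F}, c_j^{G}$ ($j\in\mathbb{Z}$), define $$\alpha(F,G)=\frac12\Big(\sum_{j\in\mathbb{Z}}|c_j^{F}-c_j^{G}|+\sum_{i\in\mathbb{Z}}|r_i^{F}-r_i^{G}|\Big).$$ Uniquely determined neighbour: let $G$ be a finite subset of $\mathbb{Z}^2$ with column sums $c_j$, and let $C$ be a finite set of $n$ column indices containing every column with non-zero column sum of $G$. A set $F_1$ is a uniquely determined neighbour of $G$ if $F_1$ is a finite uniquely determined set, $F_1$ has the same row sum as $G$ in every row, all columns of $F_1$ with index outside $C$ are empty,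 and there is an enumeration $\sigma(1),\ldots,\sigma(n)$ of $C$ with $c_{\sigma(1)}\ge c_{\sigma(2)}\ge\ldots\ge c_{\sigma(n)}$ such that the column sums $v_j$ of $F_1$ satisfy $v_{\sigma(1)}\ge v_{\sigma(2)}\ge\ldots\ge v_{\sigma(n)}$. (This depends only on the line sums of $G$ and not on the choice of $C$.) *)

theory Defs
  imports "HOL-Analysis.Analysis"
begin

definition row_sum :: "(int \<times> int) set \<Rightarrow> int \<Rightarrow> nat" where
  "row_sum F i = card {j. (i, j) \<in> F}"

definition col_sum :: "(int \<times> int) set \<Rightarrow> int \<Rightarrow> nat" where
  "col_sum F j = card {i. (i, j) \<in> F}"

definition same_line_sums :: "(int \<times> int) set \<Rightarrow> (int \<times> int) set \<Rightarrow> bool" where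
  "same_line_sums F G \<longleftrightarrow> (\<forall>i. row_sum F i = row_sum G i) \<and> (\<forall>j. col_sum F j = col_sum G j)"

(* The competitor F' is required to be finite because card is 0 on infinite sets. No competitor is
   lost: a set whose line sums are genuinely those of a finite set is finite. *)
definition uniquely_determined :: "(int \<times> int) set \<Rightarrow> bool" where
  "uniquely_determined F \<longleftrightarrow>
     finite F \<and> (\<forall>F'. finite F' \<and> same_line_sums F' F \<longrightarrow> F' = F)"

(* infsum instead of sum: sum over the infinite type int would be 0. For finite F and G the
   summands have finite support, so these are finite sums. *)
definition alpha :: "(int \<times> int) set \<Rightarrow> (int \<times> int) set \<Rightarrow> real" where
  "alpha F G =
     1 / 2 * ((\<Sum>\<^sub>\<infinity>j. \<bar>real (col_sum F j) - real (col_sum G j)\<bar>)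
            + (\<Sum>\<^sub>\<infinity>i. \<bar>real (row_sum F i) - real (row_sum G i)\<bar>))"

definition ud_neighbour_wrt ::
    "int set \<Rightarrow> (int \<times> int) set \<Rightarrow> (int \<times> int) set \<Rightarrow> bool" where
  "ud_neighbour_wrt C F1 G \<longleftrightarrow>
     finite F1 \<and> uniquely_determined F1 \<and>
     (\<forall>i. row_sum F1 i = row_sum G i) \<and>
     (\<forall>j. j \<notin> C \<longrightarrow> {i. (i, j) \<in> F1} = {}) \<and>
     (\<exists>s :: nat \<Rightarrow> int. bij_betw s {1..card C} C \<and>
        antimono_on {1..card C} (\<lambda>k. col_sum G (s k)) \<and>
        antimono_on {1..card C} (\<lambda>k. col_sum F1 (s k)))"

(* The notion does not depend on the choice of the finite set C of columns, as long as C contains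
   all columns in which G has points; hence the existential quantifier. *)
definition ud_neighbour :: "(int \<times> int) set \<Rightarrow> (int \<times> int) set \<Rightarrow> bool" where
  "ud_neighbour F1 G \<longleftrightarrow>
     (\<exists>C. finite C \<and> {j. col_sum G j \<noteq> 0} \<subseteq> C \<and> ud_neighbour_wrt C F1 G)"

end

(* A uniquely determined set has no switching component, so its columns are nested. Hence there are
   weights x on columns and y on rows with x j + y i >= 1 on F1 and x j + y i <= 0 off F1: let x j be
   the rank of the j-th column sum v_j of F1 among its m distinct non-zero column sums. If F has the
   same row sums as F1, then summing x j + y i over F1 and over F and subtracting gives
     |F1 - F| <= sum_j x j (v_j - c_j) <= m alpha(F, F1),
   because 0 <= x <= m. Moreover m (m + 1) / 2 <= |F1|, since m distinct positive integers occur
   as column sums. Finally apply this to both F2 and F3. *)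
theory Submission
  imports Defs
begin

lemma card_row_fiber: "card {p \<in> F. fst p = i} = row_sum F i"
proof -
  have "{p \<in> F. fst p = i} = Pair i ` {j. (i, j) \<in> F}" by force
  then show ?thesis by (simp add: row_sum_def card_image inj_on_def)
qed

lemma card_col_fiber: "card {p \<in> F. snd p = j} = col_sum F j"
proof -
  have "{p \<in> F. snd p = j} = (\<lambda>i. (i, j)) ` {i. (i, j) \<in> F}" by force
  then show ?thesis by (simp add: col_sum_def card_image inj_on_def)
qed

lemma finite_col: "finite F \<Longrightarrow> finite {i. (i, j) \<in> F}" for F :: "('a \<times> 'b) set"
  by (rule finite_subset[of _ "fst ` F"]) force+

lemma finite_row: "finite F \<Longrightarrow> finite {j. (i, j) \<in> F}" for F :: "('a \<times> 'b) set"
  by (rule finite_subset[of _ "snd ` F"]) force+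

lemma col_sum_eq_0: "j \<notin> snd ` F \<Longrightarrow> col_sum F j = 0"
proof -
  assume "j \<notin> snd ` F"
  then have "{i. (i, j) \<in> F} = {}" by force
  then show ?thesis by (simp add: col_sum_def)
qed

lemma col_sum_pos:
  assumes "finite F" "(i, j) \<in> F"
  shows "0 < col_sum F j"
  using assms finite_col[OF assms(1), of j] unfolding col_sum_def card_gt_0_iff by blast

lemma sum_over_rows:
  fixes y :: "int \<Rightarrow> real"
  assumes "finite F" "finite I" "fst ` F \<subseteq> I"
  shows "(\<Sum>p\<in>F. y (fst p)) = (\<Sum>i\<in>I. y i * row_sum F i)"
proof -
  have "(\<Sum>p\<in>F. y (fst p)) = (\<Sum>i\<in>I. \<Sum>p\<in>{p \<in> F. fst p = i}. y (fst p))"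
    by (rule sum.group[OF assms, symmetric])
  also have "\<dots> = (\<Sum>i\<in>I. y i * row_sum F i)"
    by (rule sum.cong) (simp_all add: card_row_fiber)
  finally show ?thesis .
qed

lemma sum_over_cols:
  fixes x :: "int \<Rightarrow> real"
  assumes "finite F" "finite J" "snd ` F \<subseteq> J"
  shows "(\<Sum>p\<in>F. x (snd p)) = (\<Sum>j\<in>J. x j * col_sum F j)"
proof -
  have "(\<Sum>p\<in>F. x (snd p)) = (\<Sum>j\<in>J. \<Sum>p\<in>{p \<in> F. snd p = j}. x (snd p))"
    by (rule sum.group[OF assms, symmetric])
  also have "\<dots> = (\<Sum>j\<in>J. x j * col_sum F j)"
    by (rule sum.cong) (simp_all add: card_col_fiber)
  finally show ?thesis .
qed

text \<open>A weighting by rows cannot tell apart two sets with equal row sums, so the row part of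
  the weight cancels in the main estimate.\<close>

lemma sum_over_rows_cong:
  fixes y :: "int \<Rightarrow> real"
  assumes "finite F" "finite G" "\<And>i. row_sum F i = row_sum G i"
  shows "(\<Sum>p\<in>F. y (fst p)) = (\<Sum>p\<in>G. y (fst p))"
  using assms by (simp add: sum_over_rows[where I = "fst ` F \<union> fst ` G"])

lemma card_eq_if_row_sums_eq:
  assumes "finite F" "finite G" "\<And>i. row_sum F i = row_sum G i"
  shows "card F = card G"
  using sum_over_rows_cong[OF assms, of "\<lambda>_. 1"] by simp

text \<open>Otherwise column \<open>j'\<close> has a point in some row \<open>i'\<close> missed by
  column \<open>j\<close>. Rows \<open>i\<close>, \<open>i'\<close> and columns \<open>j\<close>,
  \<open>j'\<close> then form a switching component, and swapping its diagonals gives a different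
  set with the same line sums.\<close>

lemma uniquely_determined_columns_nested:
  assumes "uniquely_determined F" "(i, j) \<in> F" "(i, j') \<notin> F"
  shows "col_sum F j' < col_sum F j"
proof (rule ccontr)
  assume "\<not> col_sum F j' < col_sum F j"
  then have le: "card {a. (a, j) \<in> F} \<le> card {a. (a, j') \<in> F}" by (simp add: col_sum_def)
  have fin: "finite F" using assms(1) by (simp add: uniquely_determined_def)
  have "\<exists>i'. (i', j') \<in> F \<and> (i', j) \<notin> F"
  proof (rule ccontr)
    assume "\<not> ?thesis"
    \<comment> \<open>The inclusion is strict because row \<open>i\<close> meets column
      \<open>j\<close> but not column \<open>j'\<close>.\<close>
    then have "{a. (a, j') \<in> F} \<subset> {a. (a, j) \<in> F}" using assms by blast
    then have "card {a. (a, j') \<in> F} < card {a. (a, j) \<in> F}"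
      by (rule psubset_card_mono[OF finite_col[OF fin]])
    with le show False by simp
  qed
  then obtain i' where i': "(i', j') \<in> F" "(i', j) \<notin> F" by blast
  have ne: "i' \<noteq> i" "j' \<noteq> j" using i' assms by auto
  define F' where "F' = (F - {(i, j), (i', j')}) \<union> {(i, j'), (i', j)}"
  have exchange: "card (insert b (A - {a})) = card A" if "finite A" "a \<in> A" "b \<notin> A"
    for A :: "int set" and a b
    using that card_Suc_Diff1[of A a] by simp
  have rows: "row_sum F' k = row_sum F k" for k
  proof -
    consider "k = i" | "k = i'" | "k \<noteq> i" "k \<noteq> i'" by blast
    then show ?thesis
    proof cases
      case 1
      then have "{b. (k, b) \<in> F'} = insert j' ({b. (k, b) \<in> F} - {j})"
        using ne unfolding F'_def by auto
      then show ?thesis using 1 assms exchange[OF finite_row[OF fin]] by (simp add: row_sum_def)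
    next
      case 2
      then have "{b. (k, b) \<in> F'} = insert j ({b. (k, b) \<in> F} - {j'})"
        using ne unfolding F'_def by auto
      then show ?thesis using 2 i' exchange[OF finite_row[OF fin]] by (simp add: row_sum_def)
    next
      case 3
      then show ?thesis by (simp add: row_sum_def F'_def)
    qed
  qed
  have cols: "col_sum F' k = col_sum F k" for k
  proof -
    consider "k = j" | "k = j'" | "k \<noteq> j" "k \<noteq> j'" by blast
    then show ?thesis
    proof cases
      case 1
      then have "{a. (a, k) \<in> F'} = insert i' ({a. (a, k) \<in> F} - {i})"
        using ne unfolding F'_def by auto
      then show ?thesis using 1 assms i' exchange[OF finite_col[OF fin]] by (simp add: col_sum_def)
    next
      case 2
      then have "{a. (a, k) \<in> F'} = insert i ({a. (a, k) \<in> F} - {i'})"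
        using ne unfolding F'_def by auto
      then show ?thesis using 2 assms i' exchange[OF finite_col[OF fin]] by (simp add: col_sum_def)
    next
      case 3
      then show ?thesis by (simp add: col_sum_def F'_def)
    qed
  qed
  have "finite F'" using fin by (simp add: F'_def)
  with rows cols have "F' = F"
    using assms(1) by (simp add: uniquely_determined_def same_line_sums_def)
  then show False using assms by (auto simp: F'_def)
qed

text \<open>Elements are added in increasing order: a new maximum \<open>b\<close> of a set of
  \<open>k + 1\<close> positive integers is at least \<open>k + 1\<close>, and
  \<open>k * (k + 1) + 2 * (k + 1) = (k + 1) * (k + 2)\<close>.\<close>

lemma card_triangle_le_sum:
  fixes S :: "nat set"
  assumes "finite S" "0 \<notin> S"
  shows "card S * (card S + 1) \<le> 2 * \<Sum>S"
  using assms
proof (induction S rule: finite_linorder_max_induct)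
  case empty
  then show ?case by simp
next
  case (insert b A)
  have "A \<subseteq> {1..<b}" using insert.hyps insert.prems by (auto simp: Suc_le_eq intro: gr0I)
  then have "card A \<le> b - 1" using card_mono[of "{1..<b}" A] by simp
  moreover have "b > 0" using insert.prems by auto
  ultimately have "card A + 1 \<le> b" by linarith
  moreover have "b \<notin> A" using insert.hyps by auto
  ultimately show ?case using insert by (simp add: algebra_simps)
qed

text \<open>Equal row sums kill the row part of \<open>alpha\<close>, and both column sums vanish
  outside \<open>J\<close>.\<close>

lemma alpha_eq_sum:
  assumes "\<And>i. row_sum F i = row_sum G i" "finite J" "snd ` F \<union> snd ` G \<subseteq> J"
  shows "alpha F G = 1 / 2 * (\<Sum>j\<in>J. \<bar>real (col_sum F j) - real (col_sum G j)\<bar>)"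
proof -
  have "(\<Sum>\<^sub>\<infinity>j. \<bar>real (col_sum F j) - real (col_sum G j)\<bar>)
      = (\<Sum>\<^sub>\<infinity>j\<in>J. \<bar>real (col_sum F j) - real (col_sum G j)\<bar>)"
  proof (rule infsum_cong_neutral)
    fix j assume "j \<in> UNIV - J"
    then have "j \<notin> snd ` F" "j \<notin> snd ` G" using assms(3) by auto
    then show "\<bar>real (col_sum F j) - real (col_sum G j)\<bar> = 0" by (simp add: col_sum_eq_0)
  qed auto
  then show ?thesis using assms by (simp add: alpha_def)
qed

text \<open>The weights give the bound \<open>m * alpha F F1\<close>; the factor
  \<open>sqrt 2\<close> comes from \<open>m * (m + 1) \<le> 2 * card F1\<close>.\<close>

lemma card_diff_uniquely_determined_le:
  assumes ud: "uniquely_determined F1" and fin: "finite F"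
    and rows: "\<And>i. row_sum F i = row_sum F1 i"
  shows "real (card (F1 - F)) \<le> sqrt 2 * alpha F F1 * sqrt (real (card F))"
proof -
  have fin1: "finite F1" using ud by (simp add: uniquely_determined_def)
  define J where "J = snd ` F \<union> snd ` F1"
  have J: "finite J" "snd ` F \<subseteq> J" "snd ` F1 \<subseteq> J" using fin fin1 by (auto simp: J_def)
  define v where "v = col_sum F1"
  define S where "S = v ` snd ` F1"
  define m where "m = card S"
  \<comment> \<open>The rank of \<open>v j\<close> in \<open>S\<close>, which is 0 for an empty
    column.\<close>
  define x where "x j = card (S \<inter> {..v j})" for j
  \<comment> \<open>The smallest threshold for row \<open>i\<close> that makes \<open>w\<close>
    nonpositive off \<open>F1\<close>. It is subtracted in \<open>w\<close>, so the row weight of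
    the overview is \<open>- y i\<close>.\<close>
  define y where "y i = Max (x ` {j. (i, j) \<notin> F1})" for i
  define w where "w p = real (x (snd p)) - real (y (fst p))" for p
  have S: "finite S" "0 \<notin> S"
    using fin1 col_sum_pos[OF fin1] by (auto simp: S_def v_def) (metis less_irrefl)
  have x_le: "x j \<le> m" for j unfolding x_def m_def by (rule card_mono) (use S in auto)
  have x_less: "x j' < x j" if "(i, j) \<in> F1" "(i, j') \<notin> F1" for i j j'
  proof -
    have less: "v j' < v j" using uniquely_determined_columns_nested[OF ud that] by (simp add: v_def)
    have "v j \<in> S" using that(1) by (force simp: S_def)
    \<comment> \<open>The value \<open>v j\<close> itself is counted in the rank of \<open>j\<close>
      but not in that of \<open>j'\<close>.\<close>
    then have "v j \<in> S \<inter> {..v j}" "v j \<notin> S \<inter> {..v j'}" using less by simp_all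
    moreover have "S \<inter> {..v j'} \<subseteq> S \<inter> {..v j}" using less by auto
    ultimately have "S \<inter> {..v j'} \<subset> S \<inter> {..v j}" by (metis psubsetI)
    then show ?thesis unfolding x_def by (intro psubset_card_mono) (use S in auto)
  qed
  \<comment> \<open>The maximum in \<open>y\<close> ranges over infinitely many columns, but the
    ranks take only finitely many values.\<close>
  have fin_x: "finite (x ` A)" for A
    by (rule finite_subset[of _ "{..m}"]) (use x_le in auto)
  have w_out: "w p \<le> 0" if "p \<notin> F1" for p
  proof -
    have "x (snd p) \<le> y (fst p)" unfolding y_def using that by (intro Max_ge[OF fin_x]) auto
    then show ?thesis by (simp add: w_def)
  qed
  have w_in: "1 \<le> w p" if "p \<in> F1" for p
  proof -
    obtain i j where p: "p = (i, j)" by (cases p)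
    \<comment> \<open>Row \<open>i\<close> misses some column, so the maximum defining
      \<open>y i\<close> is attained there and \<open>x_less\<close> applies.\<close>
    have "infinite (UNIV - {j. (i, j) \<in> F1} :: int set)"
      using finite_row[OF fin1, of i] by (intro Diff_infinite_finite) (auto simp: infinite_UNIV_int)
    then have "UNIV - {j. (i, j) \<in> F1} \<noteq> {}" by (metis finite.emptyI)
    then have "{j. (i, j) \<notin> F1} \<noteq> {}" by blast
    then have "y i \<in> x ` {j. (i, j) \<notin> F1}" unfolding y_def by (intro Max_in[OF fin_x]) auto
    then have "y i < x j" using x_less that p by auto
    then show ?thesis by (simp add: w_def p)
  qed
  define d where "d j = real (v j) - real (col_sum F j)" for j
  have cards: "card F = card F1" using card_eq_if_row_sums_eq[OF fin fin1 rows] .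
  have alpha: "alpha F F1 = 1 / 2 * (\<Sum>j\<in>J. \<bar>d j\<bar>)"
    using alpha_eq_sum[OF rows J(1)] J by (simp add: d_def v_def abs_minus_commute)
  have "real (card F1) = (\<Sum>j\<in>J. real (v j))"
    using sum_over_cols[OF fin1 J(1,3), of "\<lambda>_. 1"] by (simp add: v_def)
  moreover have "real (card F) = (\<Sum>j\<in>J. real (col_sum F j))"
    using sum_over_cols[OF fin J(1,2), of "\<lambda>_. 1"] by simp
  ultimately have d_sum: "(\<Sum>j\<in>J. d j) = 0" and N: "card F1 = (\<Sum>j\<in>J. v j)"
    using cards by (simp_all add: d_def sum_subtractf flip: of_nat_sum)
  have "real (card (F1 - F)) = (\<Sum>p\<in>F1 - F. 1)" by simp
  also have "\<dots> \<le> (\<Sum>p\<in>F1 - F. w p)" by (intro sum_mono) (use w_in in auto)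
  also have "\<dots> \<le> (\<Sum>p\<in>F1 - F. w p) - (\<Sum>p\<in>F - F1. w p)"
    using sum_nonpos[of "F - F1" w] w_out by auto
  \<comment> \<open>The common points of \<open>F1\<close> and \<open>F\<close> contribute equally
    to both sums.\<close>
  also have "\<dots> = (\<Sum>p\<in>F1. w p) - (\<Sum>p\<in>F. w p)"
    using sum.Int_Diff[OF fin1, of w F] sum.Int_Diff[OF fin, of w F1] by (simp add: Int_commute)
  also have "\<dots> = (\<Sum>j\<in>J. real (x j) * d j)"
    using sum_over_rows_cong[OF fin fin1 rows, of "\<lambda>i. real (y i)"]
      sum_over_cols[OF fin1 J(1,3), of "\<lambda>j. real (x j)"]
      sum_over_cols[OF fin J(1,2), of "\<lambda>j. real (x j)"]
    by (simp add: w_def d_def v_def sum_subtractf right_diff_distrib)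
  \<comment> \<open>Since the \<open>d j\<close> sum to 0, the range of \<open>x\<close> may be centred at 0, which gains a factor 2.\<close>
  also have "\<dots> = (\<Sum>j\<in>J. (real (x j) - real m / 2) * d j)"
    using d_sum sum_distrib_left[of "real m / 2" d J]
    by (simp add: left_diff_distrib sum_subtractf)
  also have "\<dots> \<le> (\<Sum>j\<in>J. real m / 2 * \<bar>d j\<bar>)"
  proof (rule sum_mono)
    fix j
    have "\<bar>real (x j) - real m / 2\<bar> \<le> real m / 2" using x_le[of j] by linarith
    then have "\<bar>(real (x j) - real m / 2) * d j\<bar> \<le> real m / 2 * \<bar>d j\<bar>"
      unfolding abs_mult by (rule mult_right_mono) simp
    then show "(real (x j) - real m / 2) * d j \<le> real m / 2 * \<bar>d j\<bar>" by linarith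
  qed
  \<comment> \<open>The \<open>1 / 2\<close> in \<open>alpha\<close> absorbs the half from
    centring.\<close>
  also have "\<dots> = real m * alpha F F1" by (simp add: alpha sum_distrib_left)
  finally have main: "real (card (F1 - F)) \<le> real m * alpha F F1" .
  \<comment> \<open>Each value in \<open>S\<close> is the sum of at least one column of
    \<open>F1\<close>; repeated values only enlarge the right side.\<close>
  have "\<Sum>S \<le> (\<Sum>j\<in>snd ` F1. v j)"
    unfolding S_def using sum_image_le[of "snd ` F1" "\<lambda>k. k" v] fin1 by simp
  also have "\<dots> \<le> card F1" unfolding N by (rule sum_mono2) (use J in auto)
  finally have "m * (m + 1) \<le> 2 * card F1"
    using card_triangle_le_sum[OF S] by (simp add: m_def)
  then have "m ^ 2 \<le> 2 * card F1" by (simp add: power2_eq_square)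
  then have "(real m)\<^sup>2 \<le> 2 * real (card F)"
    unfolding cards by (metis of_nat_le_iff of_nat_mult of_nat_numeral of_nat_power)
  then have "real m \<le> sqrt 2 * sqrt (real (card F))"
    by (simp add: real_le_rsqrt flip: real_sqrt_mult)
  moreover have "0 \<le> alpha F F1" by (simp add: alpha sum_nonneg)
  ultimately have "real m * alpha F F1 \<le> sqrt 2 * sqrt (real (card F)) * alpha F F1"
    by (rule mult_right_mono)
  with main show ?thesis by (simp add: mult_ac)
qed

theorem theorem4:
  fixes F1 F2 F3 :: "(int \<times> int) set"
  assumes "finite F2" and "F2 \<noteq> {}"
    and "finite F3" and "F3 \<noteq> {}"
    and "same_line_sums F2 F3"
    and "ud_neighbour F1 F2" and "ud_neighbour F1 F3"
  shows "real (card (F2 \<inter> F3)) / real (card F2)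
           \<ge> 1 - 2 * sqrt 2 * alpha F2 F1 / sqrt (real (card F2))"
proof -
  have ud: "uniquely_determined F1" and rows2: "\<And>i. row_sum F2 i = row_sum F1 i"
    and rows3: "\<And>i. row_sum F3 i = row_sum F1 i"
    using assms(6,7) by (auto simp: ud_neighbour_def ud_neighbour_wrt_def)
  have fin1: "finite F1" using ud by (simp add: uniquely_determined_def)
  have c2: "card F2 = card F1" using card_eq_if_row_sums_eq[OF assms(1) fin1 rows2] .
  have c3: "card F3 = card F1" using card_eq_if_row_sums_eq[OF assms(3) fin1 rows3] .
  have alpha: "alpha F3 F1 = alpha F2 F1"
    using assms(5) by (simp add: alpha_def same_line_sums_def)
  define B where "B = sqrt 2 * alpha F2 F1 * sqrt (real (card F2))"
  have "real (card (F1 - F2)) \<le> B"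
    using card_diff_uniquely_determined_le[OF ud assms(1) rows2] by (simp add: B_def)
  \<comment> \<open>Sets of equal size have differences of equal size.\<close>
  moreover have "card (F2 - F1) = card (F1 - F2)"
    using assms(1) fin1 c2 by (metis card_le_sym_Diff le_antisym order_refl)
  ultimately have b2: "real (card (F2 - F1)) \<le> B" by simp
  have b3: "real (card (F1 - F3)) \<le> B"
    using card_diff_uniquely_determined_le[OF ud assms(3) rows3] alpha c2 c3 by (simp add: B_def)
  \<comment> \<open>A triangle inequality through \<open>F1\<close>: a point of
    \<open>F2 - F3\<close> either lies outside \<open>F1\<close> or belongs to
    \<open>F1 - F3\<close>.\<close>
  have "card (F2 - F3) \<le> card ((F2 - F1) \<union> (F1 - F3))"
    using assms(1) fin1 by (intro card_mono) auto
  also have "\<dots> \<le> card (F2 - F1) + card (F1 - F3)" by (rule card_Un_le)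
  finally have "real (card (F2 - F3)) \<le> 2 * B" using b2 b3 by linarith
  moreover have "card F2 = card (F2 \<inter> F3) + card (F2 - F3)"
    using card_Int_Diff[OF assms(1)] .
  ultimately have bound: "real (card (F2 \<inter> F3)) \<ge> real (card F2) - 2 * B" by linarith
  have pos: "0 < real (card F2)" using assms(1,2) by (simp add: card_gt_0_iff)
  then have "1 / sqrt (real (card F2)) = sqrt (real (card F2)) / real (card F2)"
    by (simp add: sqrt_divide_self_eq inverse_eq_divide)
  then have "2 * sqrt 2 * alpha F2 F1 / sqrt (real (card F2)) = 2 * B / real (card F2)"
    unfolding B_def by (metis (no_types, lifting) mult.assoc mult.right_neutral times_divide_eq_right)
  with pos have "1 - 2 * sqrt 2 * alpha F2 F1 / sqrt (real (card F2))
      = (real (card F2) - 2 * B) / real (card F2)"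
    by (simp add: diff_divide_distrib)
  also have "\<dots> \<le> real (card (F2 \<inter> F3)) / real (card F2)"
    using bound pos by (intro divide_right_mono) auto
  finally show ?thesis .
qed

end
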